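(* Let $(P_n)_{n\in\omega}$ and $(Q_n)_{n\in\omega}$ be the interval partitions of $\omega$ given by $P_n=[\,0+1+\dots+n,\ 0+1+\dots+n+(n+1))$ (so $|P_n|=n+1$), $Q_0=[0,1)$ and $Q_n=[1+2+\dots+2^{n-1},\ 1+2+\dots+2^n)$ for $n>0$ (so $|Q_n|=2^n$). For $i\in P_n$ write $i=\min(P_n)+j$ with $0\le j\le n$ and let $r_i\in\mathbb{R}^{2^n}$ be given by $r_i(k)=2^{-n}(-1)^{\lfloor 2^j k/2^n\rfloor}$ for $k<2^n$. Define $x_i\in\ell_1$ for $i\in P_n$ by $\mathrm{supp}(x_i)\subseteq Q_n$, $x_i(\min(Q_n)+k)=r_i(k)/n$ for $k<2^n$ if $n>0$, and $x_0(0)=r_0(0)=1$ (all other coordinates $0$). Let \[\mathcal{J}_R=\Big\{X\subseteq\omega:\textstyle\sum_{i\in X}x_i\text{ converges unconditionally in }\ell_1\Big\},\] and for $X\subseteq\omega$ let $A_X=\{n\in\omega:P_n\cap X\neq\emptyset\}$. Then: (0) $\mathcal{J}_R$ is a tall $F_\sigma$ ideal on $\omega$; (1) if $X\in\mathcal{J}_R$ then $\sum_{n\in A_X}\frac{1}{n+1}<\infty$; (2) if $\sum_{n\in A_X,\,n\ge1}\frac{1}{\sqrt{n}}<\infty$ then $X\in\mathcal{J}_R$; (3) $\mathcal{J}_R$ is not a summable ideal, i.e. there is no $h\colon\omega\to[0,\infty)$ with $\sum_{n\in\omega}h(n)=\infty$ such that $\mathcal{J}_R=\{A\subseteq\omega:\sum_{n\in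 A}h(n)<\infty\}$.
   Context: An ideal on $\omega$ is a proper ideal of subsets of $\omega$ containing all finite sets; it is $F_\sigma$ if it is an $F_\sigma$ subset of $2^\omega$, and tall if every infinite subset of $\omega$ contains an infinite element of the ideal. A series $\sum_{i\in X}x_i$ in a Banach space converges unconditionally if the net of finite partial sums indexed by finite subsets of $X$ (ordered by inclusion) converges. *)

theory Defs
  imports "HOL-Analysis.Analysis"
begin

section \<open>The Banach space $\ell_1$\<close>

typedef l1 = "{f :: nat \<Rightarrow> real. summable (\<lambda>n. \<bar>f n\<bar>)}"
  morphisms l1_coord Abs_l1
  by (rule exI[of _ "\<lambda>_. 0"]) simp

setup_lifting type_definition_l1

lemma summable_l1_coord: "summable (\<lambda>n. \<bar>l1_coord f n\<bar>)"
  using l1_coord[of f] by simp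

lemma l1_eqI: "(\<And>n. l1_coord f n = l1_coord g n) \<Longrightarrow> f = g"
  by (metis l1_coord_inject ext)

lemma summable_abs_add:
  fixes f g :: "nat \<Rightarrow> real"
  assumes "summable (\<lambda>n. \<bar>f n\<bar>)" "summable (\<lambda>n. \<bar>g n\<bar>)"
  shows "summable (\<lambda>n. \<bar>f n + g n\<bar>)"
  by (rule summable_comparison_test'[OF summable_add[OF assms], where N = 0]) auto

instantiation l1 :: real_vector
begin

lift_definition zero_l1 :: l1 is "\<lambda>_. 0" by simp

lift_definition plus_l1 :: "l1 \<Rightarrow> l1 \<Rightarrow> l1" is "\<lambda>f g n. f n + g n"
  by (rule summable_abs_add)

lift_definition uminus_l1 :: "l1 \<Rightarrow> l1" is "\<lambda>f n. - f n" by simp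

lift_definition minus_l1 :: "l1 \<Rightarrow> l1 \<Rightarrow> l1" is "\<lambda>f g n. f n - g n"
  subgoal for f g using summable_abs_add[of f "\<lambda>n. - g n"] by simp
  done

lift_definition scaleR_l1 :: "real \<Rightarrow> l1 \<Rightarrow> l1" is "\<lambda>c f n. c * f n"
  by (simp add: abs_mult summable_mult)

instance
  by standard (transfer, simp add: algebra_simps)+

end

instantiation l1 :: real_normed_vector
begin

lift_definition norm_l1 :: "l1 \<Rightarrow> real" is "\<lambda>f. \<Sum>n. \<bar>f n\<bar>" .

definition dist_l1 :: "l1 \<Rightarrow> l1 \<Rightarrow> real"
  where "dist_l1 f g = norm (f - g)"

definition sgn_l1 :: "l1 \<Rightarrow> l1"
  where "sgn_l1 f = inverse (norm f) *\<^sub>R f"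

definition uniformity_l1 :: "(l1 \<times> l1) filter"
  where "uniformity_l1 = (INF e\<in>{0 <..}. principal {(f, g). dist f g < e})"

definition open_l1 :: "l1 set \<Rightarrow> bool"
  where "open_l1 S = (\<forall>f\<in>S. \<forall>\<^sub>F (f', g) in uniformity. f' = f \<longrightarrow> g \<in> S)"

instance
proof
  fix f g :: l1 and c :: real and S :: "l1 set"
  show "dist f g = norm (f - g)" by (rule dist_l1_def)
  show "sgn f = inverse (norm f) *\<^sub>R f" by (rule sgn_l1_def)
  show "uniformity = (INF e\<in>{0 <..}. principal {(f::l1, g). dist f g < e})"
    by (rule uniformity_l1_def)
  show "open S = (\<forall>f\<in>S. \<forall>\<^sub>F (f', g) in uniformity. f' = f \<longrightarrow> g \<in> S)"
    by (rule open_l1_def)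
  show "norm f = 0 \<longleftrightarrow> f = 0"
    by transfer (auto simp: suminf_eq_zero_iff)
  show "norm (f + g) \<le> norm f + norm g"
  proof transfer
    fix f g :: "nat \<Rightarrow> real"
    assume fg: "summable (\<lambda>n. \<bar>f n\<bar>)" "summable (\<lambda>n. \<bar>g n\<bar>)"
    have "(\<Sum>n. \<bar>f n + g n\<bar>) \<le> (\<Sum>n. \<bar>f n\<bar> + \<bar>g n\<bar>)"
      by (intro suminf_le summable_abs_add summable_add fg) auto
    also have "\<dots> = (\<Sum>n. \<bar>f n\<bar>) + (\<Sum>n. \<bar>g n\<bar>)"
      using suminf_add[OF fg] by simp
    finally show "(\<Sum>n. \<bar>f n + g n\<bar>) \<le> (\<Sum>n. \<bar>f n\<bar>) + (\<Sum>n. \<bar>g n\<bar>)" .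
  qed
  show "norm (c *\<^sub>R f) = \<bar>c\<bar> * norm f"
    by transfer (simp add: abs_mult suminf_mult)
qed

end

lemma abs_l1_coord_le_norm: "\<bar>l1_coord f n\<bar> \<le> norm f"
proof -
  have "(\<Sum>k\<in>{n}. \<bar>l1_coord f k\<bar>) \<le> (\<Sum>k. \<bar>l1_coord f k\<bar>)"
    by (intro sum_le_suminf summable_l1_coord) auto
  then show ?thesis by (simp add: norm_l1.rep_eq)
qed

instance l1 :: banach
proof
  fix X :: "nat \<Rightarrow> l1"
  assume X: "Cauchy X"
  have "Cauchy (\<lambda>m. l1_coord (X m) k)" for k
  proof (rule CauchyI)
    fix e :: real assume "e > 0"
    then obtain M where M: "\<And>m n. m \<ge> M \<Longrightarrow> n \<ge> M \<Longrightarrow> norm (X m - X n) < e"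
      using CauchyD[OF X] by blast
    have "norm (l1_coord (X m) k - l1_coord (X n) k) < e" if "m \<ge> M" "n \<ge> M" for m n
      using abs_l1_coord_le_norm[of "X m - X n" k] M[OF that] by (simp add: minus_l1.rep_eq)
    then show "\<exists>M. \<forall>m\<ge>M. \<forall>n\<ge>M. norm (l1_coord (X m) k - l1_coord (X n) k) < e"
      by blast
  qed
  then have "(\<lambda>m. l1_coord (X m) k) \<longlonglongrightarrow> lim (\<lambda>m. l1_coord (X m) k)" for k
    using Cauchy_convergent_iff convergent_LIMSEQ_iff by blast
  then obtain L where L: "\<And>k. (\<lambda>m. l1_coord (X m) k) \<longlonglongrightarrow> L k"
    using that[of "\<lambda>k. lim (\<lambda>m. l1_coord (X m) k)"] by blast
  have partial: "\<exists>M. \<forall>m\<ge>M. \<forall>N. (\<Sum>k<N. \<bar>l1_coord (X m) k - L k\<bar>) \<le> e" if e: "e > 0" for e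
  proof -
    obtain M where M: "\<And>m n. m \<ge> M \<Longrightarrow> n \<ge> M \<Longrightarrow> norm (X m - X n) < e"
      using CauchyD[OF X e] by blast
    have "(\<Sum>k<N. \<bar>l1_coord (X m) k - L k\<bar>) \<le> e" if m: "m \<ge> M" for m N
    proof (rule LIMSEQ_le_const2)
      show "(\<lambda>n. \<Sum>k<N. \<bar>l1_coord (X m) k - l1_coord (X n) k\<bar>)
              \<longlonglongrightarrow> (\<Sum>k<N. \<bar>l1_coord (X m) k - L k\<bar>)"
        by (intro tendsto_intros L)
      have "(\<Sum>k<N. \<bar>l1_coord (X m) k - l1_coord (X n) k\<bar>) \<le> e" if n: "n \<ge> M" for n
      proof -
        have "(\<Sum>k<N. \<bar>l1_coord (X m - X n) k\<bar>) \<le> norm (X m - X n)"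
          unfolding norm_l1.rep_eq by (intro sum_le_suminf summable_l1_coord) auto
        then show ?thesis using M[OF m n] by (simp add: minus_l1.rep_eq)
      qed
      then show "\<exists>K. \<forall>n\<ge>K. (\<Sum>k<N. \<bar>l1_coord (X m) k - l1_coord (X n) k\<bar>) \<le> e"
        by blast
    qed
    then show ?thesis by blast
  qed
  have summ: "summable (\<lambda>k. \<bar>l1_coord (X m) k - L k\<bar>)"
    if "\<And>N. (\<Sum>k<N. \<bar>l1_coord (X m) k - L k\<bar>) \<le> e" for m e
    by (rule summableI_nonneg_bounded[where x = e]) (use that in auto)
  obtain M where M: "\<And>N. (\<Sum>k<N. \<bar>l1_coord (X M) k - L k\<bar>) \<le> 1"
    using partial[of 1] by auto
  have "summable (\<lambda>k. \<bar>(L k - l1_coord (X M) k) + l1_coord (X M) k\<bar>)"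
    using summ[OF M] by (intro summable_abs_add summable_l1_coord) (simp add: abs_minus_commute)
  then have L_l1: "summable (\<lambda>k. \<bar>L k\<bar>)" by simp
  have coord: "l1_coord (Abs_l1 L) = L"
    using L_l1 by (simp add: Abs_l1_inverse)
  have "X \<longlonglongrightarrow> Abs_l1 L"
  proof (rule LIMSEQ_I)
    fix e :: real assume e: "e > 0"
    obtain M where M: "\<And>m N. m \<ge> M \<Longrightarrow> (\<Sum>k<N. \<bar>l1_coord (X m) k - L k\<bar>) \<le> e / 2"
      using partial[of "e / 2"] e by auto
    have "norm (X m - Abs_l1 L) < e" if "m \<ge> M" for m
    proof -
      have "norm (X m - Abs_l1 L) = (\<Sum>k. \<bar>l1_coord (X m) k - L k\<bar>)"
        by (simp add: norm_l1.rep_eq minus_l1.rep_eq coord)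
      also have "\<dots> \<le> e / 2"
        by (rule suminf_le_const[OF summ[OF M[OF that]] M[OF that]])
      finally show ?thesis using e by simp
    qed
    then show "\<exists>M. \<forall>m\<ge>M. norm (X m - Abs_l1 L) < e" by blast
  qed
  then show "convergent X" by (auto simp: convergent_def)
qed

section \<open>Ideals on $\omega$\<close>

definition ideal_on_omega :: "nat set set \<Rightarrow> bool"
  where "ideal_on_omega J \<longleftrightarrow>
    (\<forall>A. finite A \<longrightarrow> A \<in> J) \<and>
    (\<forall>A\<in>J. \<forall>B. B \<subseteq> A \<longrightarrow> B \<in> J) \<and>
    (\<forall>A\<in>J. \<forall>B\<in>J. A \<union> B \<in> J) \<and>
    UNIV \<notin> J"

definition tall :: "nat set set \<Rightarrow> bool"
  where "tall J \<longleftrightarrow> (\<forall>X. infinite X \<longrightarrow> (\<exists>Y\<subseteq>X. infinite Y \<and> Y \<in> J))"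

definition cantor_space :: "(nat \<Rightarrow> bool) topology"
  where "cantor_space = product_topology (\<lambda>_. discrete_topology UNIV) UNIV"

text \<open>Subsets of $\omega$ are identified with their characteristic functions.\<close>

definition F_sigma :: "nat set set \<Rightarrow> bool"
  where "F_sigma J \<longleftrightarrow> fsigma_in cantor_space ((\<lambda>X n. n \<in> X) ` J)"

definition summable_ideal :: "nat set set \<Rightarrow> bool"
  where "summable_ideal J \<longleftrightarrow>
    (\<exists>h :: nat \<Rightarrow> real. (\<forall>n. 0 \<le> h n) \<and> \<not> h summable_on UNIV \<and> J = {A. h summable_on A})"

section \<open>The ideal $\mathcal{J}_R$\<close>

definition P_part :: "nat \<Rightarrow> nat set"
  where "P_part n = {(\<Sum>k\<le>n. k) ..< (\<Sum>k\<le>n. k) + (n + 1)}"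

definition Q_part :: "nat \<Rightarrow> nat set"
  where "Q_part n = {(\<Sum>k<n. 2 ^ k) ..< (\<Sum>k\<le>n. 2 ^ k)}"

lemma ex1_P_part: "\<exists>!n. i \<in> P_part n"
proof -
  have step: "(\<Sum>k\<le>n. k) + (n + 1) = (\<Sum>k\<le>Suc n. k)" for n :: nat
    by simp
  have mono: "(\<Sum>k\<le>m. k) \<le> (\<Sum>k\<le>n. k)" if "m \<le> n" for m n :: nat
    using that by (intro sum_mono2) auto
  have "\<exists>n. i \<in> P_part n"
  proof (induction i)
    case 0
    have "0 \<in> P_part 0" by (simp add: P_part_def)
    then show ?case ..
  next
    case (Suc i)
    then obtain n where "i \<in> P_part n" ..
    then have "Suc i \<in> P_part n \<or> Suc i \<in> P_part (Suc n)" by (auto simp: P_part_def)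
    then show ?case by blast
  qed
  moreover have "\<not> m < n" if "i \<in> P_part m" "i \<in> P_part n" for m n
    using that mono[of "Suc m" n] unfolding P_part_def step by auto
  ultimately show ?thesis by (metis linorder_neqE_nat)
qed

definition block :: "nat \<Rightarrow> nat"
  where "block i = (THE n. i \<in> P_part n)"

lemma block_eqI: "i \<in> P_part n \<Longrightarrow> block i = n"
  unfolding block_def using ex1_P_part by (rule the1_equality)

lemma in_P_part_block: "i \<in> P_part (block i)"
  unfolding block_def using ex1_P_part by (rule theI')

text \<open>Division on the naturals gives the floor of $2^j k / 2^n$. Only the values
  for \<open>k < 2 ^ n\<close> matter.\<close>

definition r_vec :: "nat \<Rightarrow> nat \<Rightarrow> real"
  where "r_vec i k = (let n = block i; j = i - Min (P_part n)
    in (-1) ^ (2 ^ j * k div 2 ^ n) / 2 ^ n)"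

lift_definition x_vec :: "nat \<Rightarrow> l1" is
  "\<lambda>i m. let n = block i in
     if m \<in> Q_part n then
       (if n = 0 then r_vec i (m - Min (Q_part n)) else r_vec i (m - Min (Q_part n)) / real n)
     else 0"
  subgoal for i
    by (rule summable_finite[where N = "Q_part (block i)"]) (auto simp: Q_part_def Let_def)
  done

lemma x_vec_coord:
  assumes "i \<in> P_part n" "k < 2 ^ n"
  shows "l1_coord (x_vec i) (Min (Q_part n) + k) = (if n = 0 then 1 else r_vec i k / real n)"
proof -
  have Q: "Q_part n = {(\<Sum>k<n. 2 ^ k) ..< (\<Sum>k<n. 2 ^ k) + 2 ^ n}"
    by (simp add: Q_part_def flip: lessThan_Suc_atMost)
  then have "Min (Q_part n) = (\<Sum>k<n. 2 ^ k)"
    by (intro Min_eqI) auto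
  with Q assms(2) have "Min (Q_part n) + k \<in> Q_part n" by simp
  moreover have "block i = n" using assms(1) by (rule block_eqI)
  ultimately show ?thesis
    using assms(2) by (auto simp: x_vec.rep_eq Let_def r_vec_def)
qed

lemma x_vec_outside: "i \<in> P_part n \<Longrightarrow> m \<notin> Q_part n \<Longrightarrow> l1_coord (x_vec i) m = 0"
  by (simp add: x_vec.rep_eq block_eqI Let_def)

text \<open>Convergence of the net of finite partial sums is exactly the library's \<open>summable_on\<close>.\<close>

definition J\<^sub>R :: "nat set set"
  where "J\<^sub>R = {X. x_vec summable_on X}"

definition A_blocks :: "nat set \<Rightarrow> nat set"
  where "A_blocks X = {n. P_part n \<inter> X \<noteq> {}}"

end

(* Blocks have disjoint supports, so norms of finite sums add over blocks. Within block n the vectors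
   n x_i are orthogonal signs scaled by 2^-n, so a sum of m of them has norm at most sqrt m / n
   (Cauchy-Schwarz), while a single one has norm exactly 1 / n. These two estimates give (2) and (1).
   They also refute a summable representation by a weight h: the masses of h on whole blocks must tend
   to 0, so lightest elements chosen in suitable blocks have finite total mass although the
   harmonic series over these blocks diverges. *)

theory Submission
  imports Defs
begin

section \<open>Unconditional convergence in Banach spaces\<close>

text \<open>The Cauchy criterion for the net of finite partial sums. Completeness supplies the
  limit, so later arguments need only control finite sums that avoid a finite set.\<close>

lemma summable_on_Cauchy_vanishing:
  fixes f :: "'a \<Rightarrow> 'b::banach"
  shows "f summable_on A \<longleftrightarrow>
    (\<forall>e>0. \<exists>F0. finite F0 \<and> F0 \<subseteq> A \<and>
      (\<forall>F. finite F \<and> F \<subseteq> A \<and> F \<inter> F0 = {} \<longrightarrow> norm (sum f F) < e))" (is "_ \<longleftrightarrow> ?R")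
proof
  assume "f summable_on A"
  then obtain L where "(f has_sum L) A" by (auto simp: summable_on_def)
  then have lim: "(sum f \<longlongrightarrow> L) (finite_subsets_at_top A)" by (simp add: has_sum_def)
  show ?R
  proof (intro allI impI)
    fix e :: real assume "e > 0"
    then have "\<forall>\<^sub>F F in finite_subsets_at_top A. dist (sum f F) L < e / 2"
      using tendstoD[OF lim, of "e / 2"] by simp
    then obtain F0 where F0: "finite F0" "F0 \<subseteq> A"
      and close: "\<And>F. finite F \<Longrightarrow> F0 \<subseteq> F \<Longrightarrow> F \<subseteq> A \<Longrightarrow> dist (sum f F) L < e / 2"
      by (auto simp: eventually_finite_subsets_at_top)
    have "norm (sum f F) < e" if F: "finite F" "F \<subseteq> A" "F \<inter> F0 = {}" for F
    proof -
      have "norm (sum f F) = dist (sum f (F0 \<union> F)) (sum f F0)"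
        using F F0 by (subst sum.union_disjoint) (auto simp: dist_norm)
      also have "\<dots> < e"
        by (rule dist_triangle_half_l[where y = L]; rule close) (use F F0 in auto)
      finally show ?thesis .
    qed
    then show "\<exists>F0. finite F0 \<and> F0 \<subseteq> A \<and>
      (\<forall>F. finite F \<and> F \<subseteq> A \<and> F \<inter> F0 = {} \<longrightarrow> norm (sum f F) < e)"
      using F0 by blast
  qed
next
  assume R: ?R
  have "\<exists>P. eventually P (finite_subsets_at_top A) \<and>
              (\<forall>F F'. P F \<and> P F' \<longrightarrow> dist (sum f F) (sum f F') < e)" if e: "e > 0" for e
  proof -
    have "e / 2 > 0" using e by simp
    then obtain F0 where F0: "finite F0" "F0 \<subseteq> A"
      and small: "\<And>F. finite F \<Longrightarrow> F \<subseteq> A \<Longrightarrow> F \<inter> F0 = {} \<Longrightarrow> norm (sum f F) < e / 2"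
      using R by meson
    define P where "P F \<longleftrightarrow> finite F \<and> F0 \<subseteq> F \<and> F \<subseteq> A" for F
    \<comment> \<open>All finite sets above \<open>F0\<close> have sums within e/2 of the sum over
      \<open>F0\<close>, hence within e of each other.\<close>
    have "dist (sum f F0) (sum f F) < e / 2" if "P F" for F
    proof -
      have "dist (sum f F0) (sum f F) = norm (sum f (F - F0))"
        using that by (subst sum_diff) (auto simp: P_def dist_norm norm_minus_commute)
      also have "\<dots> < e / 2" using that by (intro small) (auto simp: P_def)
      finally show ?thesis .
    qed
    then have "\<forall>F F'. P F \<and> P F' \<longrightarrow> dist (sum f F) (sum f F') < e"
      by (metis dist_triangle_half_r)
    moreover have "eventually P (finite_subsets_at_top A)"
      unfolding eventually_finite_subsets_at_top P_def using F0 by blast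
    ultimately show ?thesis by blast
  qed
  then have "cauchy_filter (filtermap (sum f) (finite_subsets_at_top A))"
    by (simp add: cauchy_filter_metric_filtermap)
  moreover have "complete (UNIV :: 'b set)"
    by (meson Cauchy_convergent UNIV_I complete_def convergent_def)
  ultimately obtain L where "(sum f \<longlongrightarrow> L) (finite_subsets_at_top A)"
    using complete_uniform[where S = UNIV] by (force simp add: filterlim_def)
  then show "f summable_on A"
    using summable_on_def has_sum_def by blast
qed

text \<open>Picking successive indices at which the norms drop below 2^-k gives absolute convergence
  by comparison with a geometric series.\<close>

lemma summable_on_sparse_subset:
  fixes f :: "nat \<Rightarrow> 'a::banach"
  assumes f: "f \<longlonglongrightarrow> 0" and S: "infinite S"
  obtains Y where "Y \<subseteq> S" "infinite Y" "f summable_on Y"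
proof -
  have "\<exists>g. \<forall>k. (g k \<in> S \<and> norm (f (g k)) \<le> (1/2) ^ k) \<and> g k < g (Suc k)"
  proof (rule dependent_nat_choice)
    have ex: "\<exists>n. (n \<in> S \<and> norm (f n) \<le> (1/2) ^ k) \<and> m < n" for k m
    proof -
      have "\<forall>\<^sub>F n in sequentially. norm (f n) < (1/2) ^ k"
        using order_tendstoD(2)[OF tendsto_norm_zero[OF f], of "(1/2) ^ k"] by simp
      then obtain N where "\<And>n. n \<ge> N \<Longrightarrow> norm (f n) < (1/2) ^ k"
        by (auto simp: eventually_sequentially)
      moreover obtain n where "n \<in> S" "n > max m N"
        using S infinite_nat_iff_unbounded by blast
      ultimately show ?thesis by (intro exI[of _ n]) (auto intro: less_imp_le)
    qed
    show "\<exists>n. n \<in> S \<and> norm (f n) \<le> (1/2) ^ 0" using ex[of 0] by blast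
    show "\<exists>y. (y \<in> S \<and> norm (f y) \<le> (1/2) ^ Suc k) \<and> x < y" for x k
      by (rule ex)
  qed
  then obtain g where g: "\<And>k. g k \<in> S" "\<And>k. norm (f (g k)) \<le> (1/2) ^ k" and "strict_mono g"
    by (auto simp: strict_mono_Suc_iff)
  then have "inj g" by (simp add: strict_mono_imp_inj_on)
  have "summable (\<lambda>k. norm (f (g k)))"
    by (rule summable_comparison_test'[OF summable_geometric[of "1/2"], where N = 0]) (auto simp: g)
  then have "f \<circ> g summable_on UNIV"
    by (intro norm_summable_imp_summable_on) simp
  then have "f summable_on range g"
    using \<open>inj g\<close> by (simp add: summable_on_reindex)
  moreover have "infinite (range g)" using \<open>inj g\<close> by (rule range_inj_infinite)
  ultimately show thesis using that[of "range g"] g(1) by blast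
qed

section \<open>Arithmetic of the two interval partitions\<close>

lemma P_part_ge: "i \<in> P_part n \<Longrightarrow> n \<le> i"
proof -
  have "n \<le> (\<Sum>k\<le>n. k)" by (rule member_le_sum) auto
  then show "i \<in> P_part n \<Longrightarrow> n \<le> i" by (auto simp: P_part_def)
qed

lemma P_part_nonempty: "P_part n \<noteq> {}" and finite_P_part: "finite (P_part n)"
  and card_P_part: "card (P_part n) = n + 1"
  by (auto simp: P_part_def)

lemma in_P_part_iff: "i \<in> P_part n \<longleftrightarrow> block i = n"
  using block_eqI in_P_part_block by metis

lemma Min_P_part: "Min (P_part n) = (\<Sum>k\<le>n. k)"
  by (rule Min_eqI) (auto simp: P_part_def)

lemma Q_part_eq: "Q_part n = {2 ^ n - 1 ..< 2 ^ n - 1 + 2 ^ n}"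
proof -
  have "(\<Sum>k<n. 2 ^ k) = (2::nat) ^ n - 1" for n
  proof (induction n)
    case (Suc n)
    have "(1::nat) \<le> 2 ^ n" by simp
    then show ?case using Suc by simp
  qed simp
  then show ?thesis by (simp add: Q_part_def flip: lessThan_Suc_atMost)
qed

lemma Min_Q_part: "Min (Q_part n) = 2 ^ n - 1"
proof -
  have "(2::nat) ^ n - 1 < 2 ^ n - 1 + 2 ^ n" by (simp only: less_add_same_cancel1) simp
  then show ?thesis unfolding Q_part_eq by (intro Min_eqI) auto
qed

lemma Q_part_disjoint: "m \<in> Q_part n \<Longrightarrow> m \<in> Q_part n' \<Longrightarrow> n = n'"
proof -
  have "\<not> a < b" if "m \<in> Q_part a" "m \<in> Q_part b" for a b
  proof
    assume "a < b"
    then have "(2::nat) ^ Suc a \<le> 2 ^ b" by (intro power_increasing) auto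
    then show False using that by (auto simp: Q_part_eq)
  qed
  then show "m \<in> Q_part n \<Longrightarrow> m \<in> Q_part n' \<Longrightarrow> n = n'"
    by (meson linorder_neqE_nat)
qed

section \<open>Rademacher functions and their orthogonality\<close>

text \<open>On \<open>{..<2 ^ n}\<close> the functions \<open>rad a\<close> with \<open>a < n\<close> are the Rademacher functions in
  binary-digit order, and \<open>rad n\<close> is the constant \<open>1\<close>; the vector with index \<open>j\<close> has \<open>a = n - j\<close>.\<close>

definition rad :: "nat \<Rightarrow> nat \<Rightarrow> real"
  where "rad a k = (-1) ^ (k div 2 ^ a)"

lemma rad_eq_bit: "rad a k = (if bit k a then -1 else 1)"
  by (simp add: rad_def bit_iff_odd minus_one_power_iff)

text \<open>Cancelling 2^j, with j at most n, turns the floor of 2^j k / 2^n into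
  \<open>k div 2 ^ (n - j)\<close>, so the sign depends on a single binary digit of k.\<close>

lemma r_vec_eq_rad:
  assumes "i \<in> P_part n"
  shows "r_vec i k = rad (n - (i - Min (P_part n))) k / 2 ^ n"
proof -
  define j where "j = i - Min (P_part n)"
  have "j \<le> n" using assms unfolding j_def Min_P_part by (auto simp: P_part_def)
  then have "(2::nat) ^ n = 2 ^ j * 2 ^ (n - j)" by (simp flip: power_add)
  then have "2 ^ j * k div 2 ^ n = k div 2 ^ (n - j)"
    by simp
  then show ?thesis
    using assms by (simp add: r_vec_def Let_def block_eqI rad_def flip: j_def)
qed

text \<open>Flipping bit a is an involution of \<open>{..<2 ^ n}\<close> that negates
  \<open>rad a\<close> and fixes \<open>rad b\<close>, so the sum equals its own negative. The
  larger index b may be n, which covers the constant function.\<close>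

lemma rad_orthogonal_less:
  assumes "a < b" "a < n"
  shows "(\<Sum>k<2 ^ n. rad a k * rad b k) = 0"
proof -
  have flip: "flip_bit a k < 2 ^ n" if "k < 2 ^ n" for k :: nat
    by (metis assms(2) leD take_bit_flip_bit_eq take_bit_nat_eq_self_iff that)
  have flip_flip: "flip_bit a (flip_bit a k) = k" for k :: nat
    by (rule bit_eqI) (auto simp: bit_flip_bit_iff)
  have "(\<Sum>k<2 ^ n. rad a k * rad b k) = (\<Sum>k<2 ^ n. rad a (flip_bit a k) * rad b (flip_bit a k))"
    by (rule sum.reindex_bij_witness[of _ "flip_bit a" "flip_bit a"]) (simp_all add: flip flip_flip)
  also have "\<dots> = - (\<Sum>k<2 ^ n. rad a k * rad b k)"
    unfolding sum_negf[symmetric] using assms(1)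
    by (intro sum.cong refl) (simp add: rad_eq_bit bit_flip_bit_iff)
  finally show ?thesis by simp
qed

lemma rad_orthogonal:
  assumes "a \<noteq> b" "a \<le> n" "b \<le> n"
  shows "(\<Sum>k<2 ^ n. rad a k * rad b k) = 0"
  using rad_orthogonal_less[of a b n] rad_orthogonal_less[of b a n] assms
  by (cases "a < b") (auto simp: mult.commute)

text \<open>Expanding the square leaves only the diagonal, by orthogonality. Each diagonal term sums
  2^n entries equal to 4^-n.\<close>

lemma r_vec_second_moment:
  assumes "F \<subseteq> P_part n"
  shows "(\<Sum>k<2 ^ n. (\<Sum>i\<in>F. r_vec i k)\<^sup>2) = real (card F) / 2 ^ n"
proof -
  have fin: "finite F" using assms finite_P_part finite_subset by blast
  define a where "a i = n - (i - Min (P_part n))" for i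
  have r: "r_vec i k = rad (a i) k / 2 ^ n" if "i \<in> F" for i k
    using r_vec_eq_rad that assms by (auto simp: a_def)
  \<comment> \<open>Offsets inside block n are at most n, so the truncated subtraction defining
    \<open>a\<close> loses nothing.\<close>
  have a_inj: "a i \<noteq> a j" if "i \<in> F" "j \<in> F" "i \<noteq> j" for i j
    using that(3) subsetD[OF assms that(1)] subsetD[OF assms that(2)]
    unfolding a_def Min_P_part by (auto simp: P_part_def)
  have rr: "(\<Sum>k<2 ^ n. r_vec i k * r_vec j k) = (if i = j then 1 / 2 ^ n else 0)"
    if ij: "i \<in> F" "j \<in> F" for i j
  proof -
    have "(\<Sum>k<2 ^ n. r_vec i k * r_vec j k) =
      (\<Sum>k<2 ^ n. rad (a i) k * rad (a j) k) / (2 ^ n * 2 ^ n)"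
      using ij by (simp add: r sum_divide_distrib)
    also have "(\<Sum>k<2 ^ n. rad (a i) k * rad (a j) k) = (if i = j then 2 ^ n else 0)"
    proof (cases "i = j")
      case True
      then show ?thesis by (simp add: rad_eq_bit if_distrib cong: if_cong)
    next
      case False
      then show ?thesis using rad_orthogonal a_inj ij by (auto simp: a_def)
    qed
    finally show ?thesis by auto
  qed
  have "(\<Sum>k<2 ^ n. (\<Sum>i\<in>F. r_vec i k)\<^sup>2) =
      (\<Sum>k<2 ^ n. \<Sum>i\<in>F. \<Sum>j\<in>F. r_vec i k * r_vec j k)"
    by (simp add: power2_eq_square sum_product)
  also have "\<dots> = (\<Sum>i\<in>F. \<Sum>j\<in>F. \<Sum>k<2 ^ n. r_vec i k * r_vec j k)"
    by (subst sum.swap, rule sum.cong[OF refl], rule sum.swap)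
  also have "\<dots> = (\<Sum>i\<in>F. \<Sum>j\<in>F. if i = j then 1 / 2 ^ n else 0)"
    by (intro sum.cong refl rr)
  also have "\<dots> = real (card F) / 2 ^ n"
    using fin by simp
  finally show ?thesis .
qed

section \<open>Norms of finite partial sums in l1\<close>

lemma l1_coord_sum: "l1_coord (\<Sum>i\<in>F. f i) m = (\<Sum>i\<in>F. l1_coord (f i) m)"
  by (induction F rule: infinite_finite_induct) (auto simp: zero_l1.rep_eq plus_l1.rep_eq)

lemma norm_add_disjoint_support:
  assumes "\<And>m. l1_coord f m = 0 \<or> l1_coord g m = 0"
  shows "norm (f + g) = norm f + norm g"
proof -
  have "\<bar>l1_coord (f + g) m\<bar> = \<bar>l1_coord f m\<bar> + \<bar>l1_coord g m\<bar>" for m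
    using assms[of m] by (auto simp: plus_l1.rep_eq)
  then show ?thesis
    by (simp add: norm_l1.rep_eq suminf_add summable_l1_coord)
qed

lemma norm_sum_x_vec_separated:
  assumes "finite F" "finite G" and sep: "\<And>i j. i \<in> F \<Longrightarrow> j \<in> G \<Longrightarrow> block i \<noteq> block j"
  shows "norm (sum x_vec (F \<union> G)) = norm (sum x_vec F) + norm (sum x_vec G)"
proof -
  have "F \<inter> G = {}" using sep by blast
  then have "sum x_vec (F \<union> G) = sum x_vec F + sum x_vec G"
    using assms by (intro sum.union_disjoint)
  moreover have "l1_coord (sum x_vec F) m = 0 \<or> l1_coord (sum x_vec G) m = 0" for m
  proof (rule disjCI)
    assume "l1_coord (sum x_vec G) m \<noteq> 0"
    then obtain j where j: "j \<in> G" "l1_coord (x_vec j) m \<noteq> 0"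
      by (auto simp: l1_coord_sum dest: sum.not_neutral_contains_not_neutral)
    then have "m \<in> Q_part (block j)" using x_vec_outside in_P_part_block by blast
    then have "l1_coord (x_vec i) m = 0" if "i \<in> F" for i
      using sep[OF that j(1)] Q_part_disjoint x_vec_outside in_P_part_block by metis
    then show "l1_coord (sum x_vec F) m = 0" by (simp add: l1_coord_sum)
  qed
  ultimately show ?thesis by (simp add: norm_add_disjoint_support)
qed

text \<open>The divisor \<open>max 1 (real n)\<close> combines the factor 1/n of the positive blocks
  with the exceptional block 0, whose only vector is not rescaled.\<close>

lemma norm_sum_x_vec_block:
  assumes F: "F \<subseteq> P_part n"
  shows "norm (sum x_vec F) = (\<Sum>k<2 ^ n. \<bar>\<Sum>i\<in>F. r_vec i k\<bar>) / max 1 (real n)"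
proof -
  have coord: "l1_coord (sum x_vec F) (2 ^ n - 1 + k) = (\<Sum>i\<in>F. r_vec i k) / max 1 (real n)"
    if "k < 2 ^ n" for k
  proof -
    have "l1_coord (x_vec i) (2 ^ n - 1 + k) = r_vec i k / max 1 (real n)" if i: "i \<in> F" for i
    proof (cases "n = 0")
      case True
      then show ?thesis
        using F i \<open>k < 2 ^ n\<close> x_vec_coord[of i n k] r_vec_eq_rad[of i n k]
        by (auto simp: Min_Q_part rad_eq_bit)
    next
      case False
      then have "max 1 (real n) = real n" by simp
      then show ?thesis
        using F i \<open>k < 2 ^ n\<close> x_vec_coord[of i n k] False by (auto simp: Min_Q_part)
    qed
    then show ?thesis by (simp add: l1_coord_sum sum_divide_distrib)
  qed
  have "norm (sum x_vec F) = (\<Sum>m\<in>Q_part n. \<bar>l1_coord (sum x_vec F) m\<bar>)"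
    unfolding norm_l1.rep_eq
    using F x_vec_outside by (intro suminf_finite) (auto simp: Q_part_def l1_coord_sum intro!: sum.neutral)
  also have "\<dots> = (\<Sum>k<2 ^ n. \<bar>l1_coord (sum x_vec F) (2 ^ n - 1 + k)\<bar>)"
    unfolding Q_part_eq
    by (rule sum.reindex_bij_witness[of _ "\<lambda>k. 2 ^ n - 1 + k" "\<lambda>m. m - (2 ^ n - 1)"]) auto
  also have "\<dots> = (\<Sum>k<2 ^ n. \<bar>\<Sum>i\<in>F. r_vec i k\<bar>) / max 1 (real n)"
    unfolding sum_divide_distrib by (intro sum.cong refl) (subst coord, auto)
  finally show ?thesis .
qed

lemma norm_x_vec: "norm (x_vec i) = 1 / max 1 (real (block i))"
proof -
  have "\<bar>r_vec i k\<bar> = 1 / 2 ^ block i" for k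
    by (simp add: r_vec_eq_rad[OF in_P_part_block] rad_eq_bit)
  then show ?thesis
    using norm_sum_x_vec_block[of "{i}" "block i"] in_P_part_block[of i] by simp
qed

lemma norm_sum_x_vec_block_le:
  assumes F: "F \<subseteq> P_part n"
  shows "norm (sum x_vec F) \<le> sqrt (real (card F)) / max 1 (real n)"
proof -
  \<comment> \<open>Cauchy-Schwarz against the constant 1 contributes a factor 2^n, which cancels
    the denominator of the second moment.\<close>
  have "(\<Sum>k<2 ^ n. \<bar>\<Sum>i\<in>F. r_vec i k\<bar> * 1)\<^sup>2
      \<le> (\<Sum>k<2 ^ n. \<bar>\<Sum>i\<in>F. r_vec i k\<bar>\<^sup>2) * (\<Sum>k<(2::nat) ^ n. 1\<^sup>2)"
    by (rule Cauchy_Schwarz_ineq_sum)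
  also have "\<dots> = real (card F)"
    using r_vec_second_moment[OF F] by simp
  finally have "(\<Sum>k<2 ^ n. \<bar>\<Sum>i\<in>F. r_vec i k\<bar>) \<le> sqrt (real (card F))"
    by (intro real_le_rsqrt) simp
  then show ?thesis
    unfolding norm_sum_x_vec_block[OF F] by (intro divide_right_mono) auto
qed

section \<open>Membership as boundedness of partial sums\<close>

text \<open>The supports of different blocks are disjoint, so once a finite subset nearly attains
  the supremum of the norms of the finite partial sums, later blocks contribute little.\<close>

lemma J\<^sub>R_iff_bounded: "X \<in> J\<^sub>R \<longleftrightarrow> (\<exists>M. \<forall>F. finite F \<and> F \<subseteq> X \<longrightarrow> norm (sum x_vec F) \<le> M)"
proof
  assume "X \<in> J\<^sub>R"
  then have "x_vec summable_on X" by (simp add: J\<^sub>R_def)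
  then obtain F0 where F0: "finite F0"
    and small: "\<And>F. finite F \<Longrightarrow> F \<subseteq> X \<Longrightarrow> F \<inter> F0 = {} \<Longrightarrow> norm (sum x_vec F) < 1"
    unfolding summable_on_Cauchy_vanishing by (metis zero_less_one)
  \<comment> \<open>The part of \<open>F\<close> inside \<open>F0\<close> costs at most the total
    norm of \<open>F0\<close>; the part outside costs less than 1.\<close>
  have "norm (sum x_vec F) \<le> (\<Sum>i\<in>F0. norm (x_vec i)) + 1" if F: "finite F" "F \<subseteq> X" for F
  proof -
    have "norm (sum x_vec F) = norm (sum x_vec (F \<inter> F0) + sum x_vec (F - F0))"
      by (simp only: sum.Int_Diff[OF F(1), of x_vec F0])
    also have "\<dots> \<le> norm (sum x_vec (F \<inter> F0)) + norm (sum x_vec (F - F0))"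
      by (rule norm_triangle_ineq)
    also have "norm (sum x_vec (F \<inter> F0)) \<le> (\<Sum>i\<in>F \<inter> F0. norm (x_vec i))"
      by (rule norm_sum)
    also have "\<dots> \<le> (\<Sum>i\<in>F0. norm (x_vec i))"
      using F0 by (intro sum_mono2) auto
    also have "norm (sum x_vec (F - F0)) \<le> 1"
      using F by (intro less_imp_le[OF small]) auto
    finally show ?thesis by simp
  qed
  then show "\<exists>M. \<forall>F. finite F \<and> F \<subseteq> X \<longrightarrow> norm (sum x_vec F) \<le> M" by blast
next
  assume "\<exists>M. \<forall>F. finite F \<and> F \<subseteq> X \<longrightarrow> norm (sum x_vec F) \<le> M"
  then obtain M where M: "\<And>F. finite F \<Longrightarrow> F \<subseteq> X \<Longrightarrow> norm (sum x_vec F) \<le> M" by blast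
  define S where "S = (SUP F\<in>{F. finite F \<and> F \<subseteq> X}. norm (sum x_vec F))"
  have bdd: "bdd_above ((\<lambda>F. norm (sum x_vec F)) ` {F. finite F \<and> F \<subseteq> X})"
    using M by (intro bdd_aboveI2[where M = M]) auto
  have "x_vec summable_on X"
    unfolding summable_on_Cauchy_vanishing
  proof (intro allI impI)
    fix e :: real assume "e > 0"
    then have "S - e < (SUP F\<in>{F. finite F \<and> F \<subseteq> X}. norm (sum x_vec F))"
      by (simp add: S_def)
    then obtain F where F: "finite F" "F \<subseteq> X" "S - e < norm (sum x_vec F)"
      using bdd by (subst (asm) less_cSUP_iff) auto
    \<comment> \<open>All of X in the finitely many blocks met by \<open>F\<close> is removed, so a
      subset of X avoiding \<open>F0\<close> shares no block with \<open>F\<close> and its norm adds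
      to that of \<open>F\<close>.\<close>
    define F0 where "F0 = X \<inter> (\<Union>n\<in>block ` F. P_part n)"
    have "norm (sum x_vec G) < e" if G: "finite G" "G \<subseteq> X" "G \<inter> F0 = {}" for G
    proof -
      have "block i \<noteq> block j" if "i \<in> F" "j \<in> G" for i j
      proof
        assume "block i = block j"
        then have "block j \<in> block ` F" using that(1) by (metis imageI)
        then have "j \<in> F0" unfolding F0_def using that(2) G(2) in_P_part_block by blast
        then show False using that G(3) by blast
      qed
      then have "norm (sum x_vec F) + norm (sum x_vec G) = norm (sum x_vec (F \<union> G))"
        using F G by (intro norm_sum_x_vec_separated[symmetric]) auto
      also have "\<dots> \<le> S"
        unfolding S_def using F G by (intro cSUP_upper bdd) auto
      finally show ?thesis using F by simp
    qed
    moreover have "finite F0" "F0 \<subseteq> X"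
      using F finite_P_part by (auto simp: F0_def)
    ultimately show "\<exists>F0. finite F0 \<and> F0 \<subseteq> X \<and>
        (\<forall>F. finite F \<and> F \<subseteq> X \<and> F \<inter> F0 = {} \<longrightarrow> norm (sum x_vec F) < e)"
      by blast
  qed
  then show "X \<in> J\<^sub>R" by (simp add: J\<^sub>R_def)
qed

section \<open>The harmonic and the inverse square root conditions\<close>

text \<open>With one vector per block the supports are pairwise disjoint, so nothing cancels and the
  individual norms add up.\<close>

lemma norm_sum_x_vec_selector:
  assumes "finite B" "\<And>n. n \<in> B \<Longrightarrow> s n \<in> P_part n"
  shows "norm (\<Sum>n\<in>B. x_vec (s n)) = (\<Sum>n\<in>B. 1 / max 1 (real n))"
  using assms
proof (induction B)
  case empty
  show ?case by simp
next
  case (insert n B)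
  then have s: "block (s m) = m" if "m \<in> insert n B" for m
    using that block_eqI by blast
  then have "inj_on s (insert n B)" by (metis inj_onI)
  then have "(\<Sum>m\<in>insert n B. x_vec (s m)) = sum x_vec ({s n} \<union> s ` B)"
    using insert.hyps by (subst sum.reindex[of s "insert n B", symmetric, unfolded o_def]) (auto simp: o_def)
  also have "norm \<dots> = norm (sum x_vec {s n}) + norm (sum x_vec (s ` B))"
    using insert.hyps s by (intro norm_sum_x_vec_separated) auto
  also have "norm (sum x_vec {s n}) = 1 / max 1 (real n)"
    using s by (simp add: norm_x_vec)
  also have "sum x_vec (s ` B) = (\<Sum>m\<in>B. x_vec (s m))"
    using \<open>inj_on s (insert n B)\<close> by (subst sum.reindex) (auto elim: inj_on_subset)
  finally show ?case using insert by simp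
qed

text \<open>One element of X is chosen from every block it meets. The norms of their finite sums
  dominate the harmonic partial sums and are bounded because X lies in
  \<open>J\<^sub>R\<close>.\<close>

lemma J\<^sub>R_imp_summable_harmonic:
  assumes "X \<in> J\<^sub>R"
  shows "(\<lambda>n. 1 / (real n + 1)) summable_on A_blocks X"
proof -
  obtain M where M: "\<And>F. finite F \<Longrightarrow> F \<subseteq> X \<Longrightarrow> norm (sum x_vec F) \<le> M"
    using assms unfolding J\<^sub>R_iff_bounded by blast
  have "\<forall>n\<in>A_blocks X. \<exists>i. i \<in> P_part n \<inter> X" by (auto simp: A_blocks_def)
  then obtain s where s: "\<And>n. n \<in> A_blocks X \<Longrightarrow> s n \<in> P_part n \<inter> X"
    by metis
  show ?thesis
  proof (rule nonneg_bounded_partial_sums_imp_summable_on)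
    have "(\<Sum>n\<in>B. 1 / (real n + 1)) \<le> M" if B: "finite B" "B \<subseteq> A_blocks X" for B
    proof -
      have "(\<Sum>n\<in>B. 1 / (real n + 1)) \<le> (\<Sum>n\<in>B. 1 / max 1 (real n))"
        by (intro sum_mono divide_left_mono) auto
      also have "\<dots> = norm (\<Sum>n\<in>B. x_vec (s n))"
        using B s by (intro norm_sum_x_vec_selector[symmetric]) auto
      also have "(\<Sum>n\<in>B. x_vec (s n)) = sum x_vec (s ` B)"
      proof -
        have "inj_on s B" using s B by (metis IntD1 block_eqI inj_onI subsetD)
        then show ?thesis by (simp add: sum.reindex)
      qed
      also have "norm \<dots> \<le> M" using B s by (intro M) auto
      finally show ?thesis .
    qed
    then show "\<forall>\<^sub>F B in finite_subsets_at_top (A_blocks X). (\<Sum>n\<in>B. 1 / (real n + 1)) \<le> M"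
      by (intro eventually_finite_subsets_at_top_weakI)
  qed auto
qed

text \<open>Block n has n + 1 elements, so any part of it has norm of order at most 1 / sqrt n. The
  triangle inequality over the blocks then bounds all finite partial sums.\<close>

lemma summable_inverse_sqrt_imp_J\<^sub>R:
  assumes "(\<lambda>n. 1 / sqrt (real n)) summable_on {n \<in> A_blocks X. n \<ge> 1}"
  shows "X \<in> J\<^sub>R"
proof -
  let ?A = "{n \<in> A_blocks X. n \<ge> 1}" and ?f = "\<lambda>n. 1 / sqrt (real n)"
  \<comment> \<open>The constant sqrt 2 comes from n + 1 \<le> 2 n for positive n. Since
    \<open>?f 0\<close> is 0 by the convention for division by zero, block 0 gets its own summand
    1.\<close>
  have blockwise: "norm (sum x_vec G) \<le> (if n = 0 then 1 else 0) + sqrt 2 * ?f n"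
    if G: "G \<subseteq> P_part n" for G n
  proof -
    have "card G \<le> n + 1" using G card_mono finite_P_part card_P_part by metis
    then have "norm (sum x_vec G) \<le> sqrt (real n + 1) / max 1 (real n)"
      using norm_sum_x_vec_block_le[OF G]
      by (elim order_trans) (auto intro!: divide_right_mono)
    also have "\<dots> \<le> (if n = 0 then 1 else 0) + sqrt 2 * ?f n"
    proof (cases "n = 0")
      case False
      then have "sqrt (real n + 1) \<le> sqrt 2 * sqrt (real n)"
        by (simp flip: real_sqrt_mult)
      then have "sqrt (real n + 1) / real n \<le> sqrt 2 * sqrt (real n) / real n"
        by (intro divide_right_mono) auto
      also have "\<dots> = sqrt 2 * ?f n"
        using False by (simp add: field_simps)
      finally show ?thesis using False by simp
    qed simp
    finally show ?thesis .
  qed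
  have "norm (sum x_vec F) \<le> 1 + sqrt 2 * infsum ?f ?A" if F: "finite F" "F \<subseteq> X" for F
  proof -
    have "norm (sum x_vec F) = norm (\<Sum>n\<in>block ` F. sum x_vec {i \<in> F. block i = n})"
      using sum.image_gen[OF F(1), of x_vec block] by simp
    also have "\<dots> \<le> (\<Sum>n\<in>block ` F. norm (sum x_vec {i \<in> F. block i = n}))"
      by (rule norm_sum)
    also have "\<dots> \<le> (\<Sum>n\<in>block ` F. (if n = 0 then 1 else 0) + sqrt 2 * ?f n)"
      by (intro sum_mono blockwise) (auto simp: in_P_part_iff)
    also have "\<dots> = (\<Sum>n\<in>block ` F. if n = 0 then 1 else 0) + sqrt 2 * (\<Sum>n\<in>block ` F. ?f n)"
      by (simp add: sum.distrib sum_distrib_left)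
    also have "(\<Sum>n\<in>block ` F. if n = 0 then 1 else 0) \<le> (1::real)"
      using F by simp
    also have "(\<Sum>n\<in>block ` F. ?f n) = (\<Sum>n\<in>block ` F - {0}. ?f n)"
      using F by (intro sum.mono_neutral_right) auto
    also have "\<dots> \<le> infsum ?f ?A"
      using F in_P_part_block by (intro finite_sum_le_infsum assms) (auto simp: A_blocks_def)
    finally show ?thesis by simp
  qed
  then show ?thesis unfolding J\<^sub>R_iff_bounded by blast
qed

section \<open>Ideal, tallness and Borel complexity\<close>

lemma not_summable_on_harmonic: "\<not> (\<lambda>n. 1 / (real n + 1)) summable_on UNIV"
  using not_summable_harmonic[where 'a = real] summable_Suc_iff[where f = "\<lambda>n. inverse (real n)"]
  by (auto simp: summable_on_UNIV_nonneg_real_iff inverse_eq_divide add.commute)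

lemma ideal_J\<^sub>R: "ideal_on_omega J\<^sub>R"
proof -
  have "A \<union> B \<in> J\<^sub>R" if "A \<in> J\<^sub>R" "B \<in> J\<^sub>R" for A B
  proof -
    have "x_vec summable_on (A \<union> (B - A))"
      using that summable_on_subset_banach[of x_vec B "B - A"]
      by (intro summable_on_Un_disjoint) (auto simp: J\<^sub>R_def)
    then show ?thesis by (simp add: J\<^sub>R_def)
  qed
  \<comment> \<open>Properness: the whole set meets every block, so its membership would make the
    harmonic series converge.\<close>
  moreover have "A_blocks UNIV = UNIV"
    using P_part_nonempty by (auto simp: A_blocks_def)
  then have "UNIV \<notin> J\<^sub>R"
    using J\<^sub>R_imp_summable_harmonic[of UNIV] not_summable_on_harmonic by auto
  ultimately show ?thesis
    unfolding ideal_on_omega_def by (auto simp: J\<^sub>R_def intro: summable_on_subset_banach)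
qed

lemma filterlim_block: "filterlim block at_top sequentially"
  unfolding filterlim_at_top
proof
  fix N
  have "finite {i. block i < N}"
  proof (rule finite_subset)
    show "{i. block i < N} \<subseteq> (\<Union>n<N. P_part n)" using in_P_part_block by auto
    show "finite (\<Union>n<N. P_part n)" using finite_P_part by auto
  qed
  then have "\<forall>\<^sub>F i in cofinite. \<not> block i < N" by (simp add: eventually_cofinite)
  then show "\<forall>\<^sub>F i in sequentially. N \<le> block i"
    by (simp add: cofinite_eq_sequentially not_less)
qed

text \<open>Blocks are finite, so block indices tend to infinity and the norms of the vectors tend
  to 0; every infinite set then has an infinite sparse subset over which they are summable.\<close>

lemma tall_J\<^sub>R: "tall J\<^sub>R"
proof -
  have "(\<lambda>n. 1 / max 1 (real n)) \<longlonglongrightarrow> 0"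
    by (rule Lim_transform_eventually[OF lim_1_over_n])
      (auto simp: eventually_sequentially intro!: exI[of _ 1])
  then have "(\<lambda>i. 1 / max 1 (real (block i))) \<longlonglongrightarrow> 0"
    by (rule filterlim_compose[OF _ filterlim_block])
  then have "x_vec \<longlonglongrightarrow> 0"
    by (simp add: tendsto_norm_zero_iff[of x_vec, symmetric] norm_x_vec)
  then show ?thesis
    unfolding tall_def J\<^sub>R_def by (metis mem_Collect_eq summable_on_sparse_subset)
qed

text \<open>For fixed M, the sets whose finite partial sums all have norm at most M form a closed
  set; by the boundedness criterion \<open>J\<^sub>R\<close> is the union of these over natural
  M.\<close>

lemma F_sigma_J\<^sub>R: "F_sigma J\<^sub>R"
proof -
  let ?T = "cantor_space"
  have topspace: "topspace ?T = UNIV" by (simp add: cantor_space_def)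
  have coord: "closedin ?T {c. \<not> c i}" for i
  proof -
    have "continuous_map ?T (discrete_topology UNIV) (\<lambda>c. c i)"
      unfolding cantor_space_def by (rule continuous_map_product_projection) simp
    from closedin_continuous_map_preimage[OF this, of "{False}"] show ?thesis
      by (simp add: topspace)
  qed
  \<comment> \<open>A set lies in \<open>C M\<close> iff it omits some element of every finite F
    whose sum has norm above M. Omitting a given point is a closed condition, and each inner union
    is finite.\<close>
  define C where "C M = (\<Inter>F\<in>{F. finite F \<and> norm (sum x_vec F) > M}. \<Union>i\<in>F. {c. \<not> c i})" for M :: real
  have closed: "closedin ?T (C M)" for M
  proof (cases "\<exists>F. finite F \<and> norm (sum x_vec F) > M")
    case True
    then show ?thesis
      unfolding C_def by (intro closedin_Inter) (auto intro!: closedin_Union coord)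
  next
    case False
    then have "C M = topspace ?T" by (auto simp: C_def topspace)
    then show ?thesis by simp
  qed
  have in_C: "(\<lambda>n. n \<in> X) \<in> C M \<longleftrightarrow> (\<forall>F. finite F \<and> F \<subseteq> X \<longrightarrow> norm (sum x_vec F) \<le> M)" for X M
    unfolding C_def by (auto simp: not_le)
  have "(\<lambda>X n. n \<in> X) ` J\<^sub>R = (\<Union>M::nat. C (real M))"
  proof (intro equalityI subsetI)
    fix c assume "c \<in> (\<lambda>X n. n \<in> X) ` J\<^sub>R"
    then obtain X where X: "X \<in> J\<^sub>R" "c = (\<lambda>n. n \<in> X)" by blast
    then obtain M where M: "\<And>F. finite F \<Longrightarrow> F \<subseteq> X \<Longrightarrow> norm (sum x_vec F) \<le> M"
      unfolding J\<^sub>R_iff_bounded by blast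
    obtain m where "M \<le> real m" using real_arch_simple by blast
    then have "c \<in> C (real m)"
      unfolding X(2) in_C using M order_trans by blast
    then show "c \<in> (\<Union>M::nat. C (real M))" by blast
  next
    fix c assume "c \<in> (\<Union>M::nat. C (real M))"
    then obtain M where "(\<lambda>n. n \<in> Collect c) \<in> C (real M)" by auto
    then have "Collect c \<in> J\<^sub>R" unfolding in_C J\<^sub>R_iff_bounded by blast
    then show "c \<in> (\<lambda>X n. n \<in> X) ` J\<^sub>R" by (rule rev_image_eqI) simp
  qed
  moreover have "fsigma_in ?T (\<Union>M::nat. C (real M))"
    by (rule fsigma_in_Union) (auto intro: closed_imp_fsigma_in closed)
  ultimately show ?thesis by (simp add: F_sigma_def)
qed

section \<open>Failure of every summable representation\<close>

text \<open>The set is a sparse union of dyadic intervals: each of them has harmonic mass between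
  \<open>1/2\<close> and \<open>1\<close>, while the null sequence is at most \<open>2 ^ - k\<close> on the \<open>k\<close>-th.\<close>

lemma null_sequence_harmonic_set:
  fixes e :: "nat \<Rightarrow> real"
  assumes e: "e \<longlonglongrightarrow> 0" and nonneg: "\<And>n. 0 \<le> e n"
  obtains B where "\<not> (\<lambda>n. 1 / (real n + 1)) summable_on B"
    "(\<lambda>n. e n / (real n + 1)) summable_on B"
proof -
  have "\<exists>p. \<forall>k. (\<forall>n\<ge>2 ^ p k. e n \<le> (1/2) ^ k) \<and> p k < p (Suc k)"
  proof (rule dependent_nat_choice)
    have ex: "\<exists>p. (\<forall>n\<ge>2 ^ p. e n \<le> (1/2) ^ k) \<and> q < p" for k and q :: nat
    proof -
      have "\<forall>\<^sub>F n in sequentially. e n < (1/2) ^ k"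
        using order_tendstoD(2)[OF e, of "(1/2) ^ k"] by simp
      then obtain N where N: "\<And>n. n \<ge> N \<Longrightarrow> e n < (1/2) ^ k"
        by (auto simp: eventually_sequentially)
      define p where "p = Suc (max q N)"
      \<comment> \<open>Since p exceeds N, so does 2^p; p also exceeds q, which keeps the chosen
        dyadic intervals disjoint.\<close>
      have "N \<le> 2 ^ p" by (rule order_trans[OF _ less_imp_le[OF less_exp]]) (simp add: p_def)
      then show ?thesis
        using N by (intro exI[of _ p]) (auto simp: p_def intro!: less_imp_le)
    qed
    show "\<exists>p. \<forall>n\<ge>2 ^ p. e n \<le> (1/2) ^ 0" using ex[of 0] by blast
    show "\<exists>y. (\<forall>n\<ge>2 ^ y. e n \<le> (1/2) ^ Suc k) \<and> x < y" for x k by (rule ex)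
  qed
  then obtain p where p: "\<And>k n. n \<ge> 2 ^ p k \<Longrightarrow> e n \<le> (1/2) ^ k" and mono: "strict_mono p"
    by (auto simp: strict_mono_Suc_iff)
  define I where "I k = {2 ^ p k ..< 2 ^ Suc (p k) :: nat}" for k
  define B where "B = (\<Union>k. I k)"
  have lower: "1/2 \<le> (\<Sum>n\<in>I k. 1 / (real n + 1))" for k
  proof -
    \<comment> \<open>There are 2^(p k) terms, each at least 2^-(p k + 1).\<close>
    have "(\<Sum>n\<in>I k. 1 / 2 ^ Suc (p k)) \<le> (\<Sum>n\<in>I k. 1 / (real n + 1))"
    proof (intro sum_mono divide_left_mono)
      fix n assume "n \<in> I k"
      then have "n + 1 \<le> 2 ^ Suc (p k)" by (simp add: I_def)
      then have "real (n + 1) \<le> real (2 ^ Suc (p k))" by (rule of_nat_mono)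
      then show "real n + 1 \<le> 2 ^ Suc (p k)" by simp
    qed auto
    then show ?thesis by (simp add: I_def field_simps)
  qed
  have upper: "(\<Sum>n\<in>I k. e n / (real n + 1)) \<le> (1/2) ^ k" for k
  proof -
    have "(\<Sum>n\<in>I k. e n / (real n + 1)) \<le> (\<Sum>n\<in>I k. (1/2) ^ k / 2 ^ p k)"
    proof (intro sum_mono frac_le)
      fix n assume n: "n \<in> I k"
      then show "e n \<le> (1/2) ^ k" using p by (simp add: I_def)
      have "2 ^ p k \<le> real n" using n by (simp add: I_def)
      then show "2 ^ p k \<le> real n + 1" by linarith
    qed auto
    then show ?thesis by (simp add: I_def)
  qed
  have disjoint: "k = l" if "n \<in> I k" "n \<in> I l" for n k l
  proof -
    have "\<not> a < b" if "n \<in> I a" "n \<in> I b" for a b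
    proof
      assume "a < b"
      then have "Suc (p a) \<le> p b" using mono by (simp add: Suc_le_eq strict_mono_less)
      then have "(2::nat) ^ Suc (p a) \<le> 2 ^ p b" by (intro power_increasing) auto
      then show False using that by (auto simp: I_def)
    qed
    then show ?thesis using that by (meson linorder_neqE_nat)
  qed
  have "\<not> (\<lambda>n. 1 / (real n + 1)) summable_on B"
  proof
    assume "(\<lambda>n. 1 / (real n + 1)) summable_on B"
    then obtain F0 where F0: "finite F0" and
      small: "\<And>F. finite F \<Longrightarrow> F \<subseteq> B \<Longrightarrow> F \<inter> F0 = {} \<Longrightarrow> norm (\<Sum>n\<in>F. 1 / (real n + 1)) < 1/2"
      unfolding summable_on_Cauchy_vanishing by (metis half_gt_zero zero_less_one)
    \<comment> \<open>The k-th interval starts beyond \<open>F0\<close>, yet its harmonic mass is at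
      least 1/2, against the Cauchy criterion.\<close>
    obtain k where k: "\<And>m. m \<in> F0 \<Longrightarrow> m < k"
      using F0 unfolding finite_nat_set_iff_bounded by blast
    have "k \<le> p k" using mono by (rule strict_mono_imp_increasing)
    then have "k < 2 ^ p k" using less_exp[of "p k"] by linarith
    then have "I k \<inter> F0 = {}" using k by (force simp: I_def)
    then have "norm (\<Sum>n\<in>I k. 1 / (real n + 1)) < 1/2"
      by (intro small) (auto simp: B_def I_def)
    then show False using lower[of k] by simp
  qed
  moreover have "(\<lambda>n. e n / (real n + 1)) summable_on B"
    unfolding B_def
  proof (rule summable_on_UnionI)
    show "((\<lambda>n. e n / (real n + 1)) has_sum (\<Sum>n\<in>I k. e n / (real n + 1))) (I k)" for k
      by (rule has_sum_finite) (simp add: I_def)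
    have "summable (\<lambda>k. \<Sum>n\<in>I k. e n / (real n + 1))"
      using upper nonneg
      by (intro summable_comparison_test'[OF summable_geometric[of "1/2"], where N = 0])
        (auto simp: sum_nonneg)
    then show "(\<lambda>k. \<Sum>n\<in>I k. e n / (real n + 1)) summable_on UNIV"
      using nonneg by (auto simp: summable_on_UNIV_nonneg_real_iff sum_nonneg)
    show "disjoint_family_on I UNIV"
      using disjoint by (auto simp: disjoint_family_on_def)
  qed (use nonneg in auto)
  ultimately show thesis using that by blast
qed

lemma not_summable_ideal_J\<^sub>R: "\<not> summable_ideal J\<^sub>R"
proof
  assume "summable_ideal J\<^sub>R"
  then obtain h :: "nat \<Rightarrow> real" where h: "\<And>n. 0 \<le> h n" and J: "J\<^sub>R = {A. h summable_on A}"
    unfolding summable_ideal_def by blast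
  define H where "H n = sum h (P_part n)" for n
  have H: "0 \<le> H n" for n using h by (simp add: H_def sum_nonneg)
  \<comment> \<open>Otherwise infinitely many blocks have mass at least some e > 0. A sparse union
    of such whole blocks satisfies the inverse square root condition and lies in
    \<open>J\<^sub>R\<close>, but h is not summable on it.\<close>
  have "H \<longlonglongrightarrow> 0"
  proof (rule ccontr)
    assume "\<not> H \<longlonglongrightarrow> 0"
    then obtain e where "e > 0" and e: "\<exists>\<^sub>F n in sequentially. H n \<ge> e"
      using H by (auto simp: tendsto_iff not_eventually not_less)
    then have inf: "infinite {n. H n \<ge> e}"
      by (simp add: frequently_cofinite flip: cofinite_eq_sequentially)
    have "(\<lambda>n. 1 / sqrt (real n)) \<longlonglongrightarrow> 0"
      by (intro tendsto_divide_0[OF tendsto_const] filterlim_at_top_imp_at_infinity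
          filterlim_compose[OF sqrt_at_top filterlim_real_sequentially])
    then obtain B where B: "B \<subseteq> {n. H n \<ge> e}" "infinite B" "(\<lambda>n. 1 / sqrt (real n)) summable_on B"
      using summable_on_sparse_subset inf by blast
    define X where "X = (\<Union>n\<in>B. P_part n)"
    have "A_blocks X = B"
      using P_part_nonempty by (auto simp: A_blocks_def X_def in_P_part_iff)
    then have "X \<in> J\<^sub>R"
      using B by (intro summable_inverse_sqrt_imp_J\<^sub>R) (auto elim: summable_on_subset_banach)
    then have "h summable_on X" using J by blast
    then obtain F0 where F0: "finite F0"
      and small: "\<And>F. finite F \<Longrightarrow> F \<subseteq> X \<Longrightarrow> F \<inter> F0 = {} \<Longrightarrow> norm (sum h F) < e"
      unfolding summable_on_Cauchy_vanishing using \<open>e > 0\<close> by metis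
    obtain k where k: "\<And>m. m \<in> F0 \<Longrightarrow> m < k"
      using F0 unfolding finite_nat_set_iff_bounded by blast
    obtain n where n: "n \<in> B" "n > k" using B(2) infinite_nat_iff_unbounded by blast
    \<comment> \<open>Every element of block n is at least n, hence beyond
      \<open>F0\<close>.\<close>
    have "P_part n \<inter> F0 = {}" using k n(2) by (metis P_part_ge disjoint_iff less_trans not_le)
    then have "norm (H n) < e"
      unfolding H_def using n finite_P_part by (intro small) (auto simp: X_def)
    then show False using B(1) n(1) by auto
  qed
  then obtain B where B: "\<not> (\<lambda>n. 1 / (real n + 1)) summable_on B"
    "(\<lambda>n. H n / (real n + 1)) summable_on B"
    using null_sequence_harmonic_set H by blast
  define s where "s n = arg_min_on h (P_part n)" for n
  have s: "s n \<in> P_part n" for n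
    unfolding s_def using finite_P_part P_part_nonempty by (rule arg_min_if_finite)
  \<comment> \<open>The minimum of h on block n is at most its average over the n + 1
    elements.\<close>
  have "real (card (P_part n)) * h (s n) \<le> H n" for n
    unfolding H_def s_def using finite_P_part
    by (intro sum_bounded_below arg_min_least) auto
  then have light: "h (s n) \<le> H n / (real n + 1)" for n
    by (simp add: card_P_part field_simps)
  have "inj s" using s by (metis block_eqI injI)
  have "(\<lambda>n. h (s n)) summable_on B"
    by (rule summable_on_comparison_test[OF B(2)]) (use light h in auto)
  then have "h summable_on s ` B"
    using \<open>inj s\<close> by (subst summable_on_reindex) (auto simp: o_def intro: inj_on_subset)
  \<comment> \<open>The lightest elements form a member of \<open>J\<^sub>R\<close> meeting exactly
    the blocks in \<open>B\<close>, on which the harmonic sum diverges.\<close>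
  then have "s ` B \<in> J\<^sub>R" using J by blast
  moreover have "A_blocks (s ` B) = B"
  proof (intro equalityI subsetI)
    show "n \<in> B" if "n \<in> A_blocks (s ` B)" for n
      using that s by (auto simp: A_blocks_def in_P_part_iff)
    show "n \<in> A_blocks (s ` B)" if "n \<in> B" for n
      unfolding A_blocks_def using that s[of n] by blast
  qed
  ultimately show False using J\<^sub>R_imp_summable_harmonic B(1) by metis
qed

theorem theorem7p1:
  shows "(ideal_on_omega J\<^sub>R \<and> tall J\<^sub>R \<and> F_sigma J\<^sub>R) \<and>
    (\<forall>X. X \<in> J\<^sub>R \<longrightarrow> (\<lambda>n. 1 / (real n + 1)) summable_on A_blocks X) \<and>
    (\<forall>X. (\<lambda>n. 1 / sqrt (real n)) summable_on {n \<in> A_blocks X. n \<ge> 1} \<longrightarrow> X \<in> J\<^sub>R) \<and>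
    \<not> summable_ideal J\<^sub>R"
  using ideal_J\<^sub>R tall_J\<^sub>R F_sigma_J\<^sub>R J\<^sub>R_imp_summable_harmonic
    summable_inverse_sqrt_imp_J\<^sub>R not_summable_ideal_J\<^sub>R by blast

end
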